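(* Asymptotically, as $m \to + \infty$, $$ \mathsf{D}^{(4)} (\{-m,\dots,m\}^3) \sim 16 m^3. $$
   Context: For a subset $X$ of an abelian group, a minimal zero-sum sequence over $X$ is a (unordered) sequence of elements of $X$ summing to $0$ with no non-empty proper subsequence summing to $0$. $\mathsf{D}^{(k)}(X)$ denotes the maximal length of a minimal zero-sum sequence over $X$ whose support (set of distinct elements) has size exactly $k$. $\{-m,\dots,m\}$ denotes the set of integers $i$ with $-m\le i\le m$. *)

theory Defs
  imports
    "HOL-Analysis.Finite_Cartesian_Product"
    "HOL-Library.Multiset"
    "HOL-Library.Landau_Symbols"
begin

text \<open>Unordered sequences are multisets, so subsequences are sub-multisets.\<close>

definition minimal_zero_sum :: "'a::ab_group_add multiset \<Rightarrow> bool" where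
  "minimal_zero_sum S \<longleftrightarrow>
     S \<noteq> {#} \<and> \<Sum>\<^sub># S = 0 \<and> (\<forall>T. T \<subset># S \<and> T \<noteq> {#} \<longrightarrow> \<Sum>\<^sub># T \<noteq> 0)"

definition min_zero_sum_seqs :: "nat \<Rightarrow> 'a::ab_group_add set \<Rightarrow> 'a multiset set" where
  "min_zero_sum_seqs k X =
     {S. minimal_zero_sum S \<and> set_mset S \<subseteq> X \<and> card (set_mset S) = k}"

text \<open>
  For finite \<open>X\<close> the supremum below is a maximum whenever there is a minimal zero-sum sequence
  over \<open>X\<close> with support of size \<open>k\<close> (lemma \<open>davenport_support_eq_Max\<close>); otherwise it is \<open>0\<close>.
\<close>

definition davenport_support :: "nat \<Rightarrow> 'a::ab_group_add set \<Rightarrow> nat" where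
  "davenport_support k X = Sup (size ` min_zero_sum_seqs k X)"

definition int_cube :: "nat \<Rightarrow> (int ^ 'n) set" where
  "int_cube m = {x. \<forall>i. x $ i \<in> {- int m..int m}}"

lemma incseq_count_subseq:
  fixes f :: "nat \<Rightarrow> 'a multiset"
  assumes "finite X"
  shows "\<exists>r. strict_mono r \<and> (\<forall>x\<in>X. incseq (\<lambda>n. count (f (r n)) x))"
  using assms
proof (induction X rule: finite_induct)
  case empty
  show ?case by (intro exI[of _ id]) (auto simp: strict_mono_def)
next
  case (insert a X)
  then obtain r where r: "strict_mono r" "\<forall>x\<in>X. incseq (\<lambda>n. count (f (r n)) x)"
    by blast
  define g where "g n = count (f (r n)) a" for n
  have "\<exists>s. strict_mono s \<and> incseq (\<lambda>n. g (s n))"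
  proof -
    obtain s where s: "strict_mono s" "monoseq (\<lambda>n. g (s n))"
      using seq_monosub[of g] by blast
    show ?thesis
    proof (cases "incseq (\<lambda>n. g (s n))")
      case True
      then show ?thesis using s by blast
    next
      case False
      then have dec: "decseq (\<lambda>n. g (s n))" using s(2) by (simp add: monoseq_iff)
      obtain N where N: "\<And>n. g (s N) \<le> g (s n)"
        using ex_has_least_nat[of "\<lambda>_. True" 0 "\<lambda>n. g (s n)"] by auto
      have const: "g (s (N + n)) = g (s N)" for n
        using decseqD[OF dec, of N "N + n"] N[of "N + n"] by simp
      have "strict_mono (\<lambda>n. s (N + n))" using s(1) by (simp add: strict_mono_def)
      moreover have "incseq (\<lambda>n. g (s (N + n)))" by (simp add: const incseq_def)
      ultimately show ?thesis by (intro exI[of _ "\<lambda>n. s (N + n)"]) simp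
    qed
  qed
  then obtain s where s: "strict_mono s" "incseq (\<lambda>n. g (s n))" by blast
  have "strict_mono (\<lambda>n. r (s n))" using r(1) s(1) by (simp add: strict_mono_def)
  moreover have "incseq (\<lambda>n. count (f (r (s n))) x)" if "x \<in> X" for x
    using r(2) that s(1) unfolding incseq_def
    by (meson strict_mono_less_eq)
  ultimately show ?case
    using s(2) by (intro exI[of _ "\<lambda>n. r (s n)"]) (auto simp: g_def)
qed

lemma finite_min_zero_sum_seqs:
  assumes "finite X"
  shows "finite (min_zero_sum_seqs k X)"
proof (rule ccontr)
  assume "infinite (min_zero_sum_seqs k X)"
  then obtain f :: "nat \<Rightarrow> 'a multiset" where f: "inj f" "range f \<subseteq> min_zero_sum_seqs k X"
    using infinite_countable_subset by blast
  obtain r where r: "strict_mono r" "\<forall>x\<in>X. incseq (\<lambda>n. count (f (r n)) x)"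
    using incseq_count_subseq[OF assms, of f] by blast
  have mem: "f n \<in> min_zero_sum_seqs k X" for n using f(2) by blast
  have "f (r 0) \<subseteq># f (r 1)"
  proof (rule mset_subset_eqI)
    fix x
    show "count (f (r 0)) x \<le> count (f (r 1)) x"
    proof (cases "x \<in> X")
      case True
      then show ?thesis using r(2) by (auto simp: incseq_def)
    next
      case False
      then have "x \<notin># f (r 0)" using mem[of "r 0"] by (auto simp: min_zero_sum_seqs_def)
      then show ?thesis by (simp add: not_in_iff)
    qed
  qed
  moreover have "f (r 0) \<noteq> f (r 1)"
    using f(1) r(1) by (metis injD strict_mono_eq zero_neq_one)
  ultimately show False
    using mem[of "r 0"] mem[of "r 1"]
    by (auto simp: min_zero_sum_seqs_def minimal_zero_sum_def subset_mset.less_le)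
qed

lemma davenport_support_eq_Max:
  assumes "finite X" and "min_zero_sum_seqs k X \<noteq> {}"
  shows "davenport_support k X = Max (size ` min_zero_sum_seqs k X)"
  unfolding davenport_support_def
  using assms finite_min_zero_sum_seqs by (intro cSup_eq_Max) auto

lemma finite_int_cube: "finite (int_cube m :: (int ^ 'n) set)"
proof -
  have "int_cube m \<subseteq> vec_lambda ` (UNIV \<rightarrow>\<^sub>E {- int m..int m} :: ('n \<Rightarrow> int) set)"
  proof
    fix x :: "int ^ 'n"
    assume "x \<in> int_cube m"
    then have "vec_nth x \<in> UNIV \<rightarrow>\<^sub>E {- int m..int m}"
      by (auto simp: int_cube_def)
    then show "x \<in> vec_lambda ` (UNIV \<rightarrow>\<^sub>E {- int m..int m})"
      by (metis imageI vec_nth_inverse)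
  qed
  then show ?thesis
    by (rule finite_subset) (intro finite_imageI finite_PiE, auto)
qed

end

theory Submission
  imports Defs "HOL-Analysis.Cartesian_Space" "HOL-Real_Asymp.Real_Asymp"
begin

text \<open>
  If the four vectors in the support span a space of dimension three, the multiplicities of a
  minimal zero-sum sequence are proportional to, hence bounded by, the \<open>3 \<times> 3\<close> minors. The sum of
  the absolute minors is six times the volume of a simplex in the cube, so at most \<open>16 m\<^sup>3\<close>.
  If the vectors lie in a plane, the length is only \<open>O(m\<^sup>2)\<close>. Conversely, a tetrahedron close to a
  regular one with coprime minors attains \<open>16 m\<^sup>3 - O(m\<^sup>2)\<close>.
\<close>

section \<open>Minimality in terms of multiplicities\<close>

lemma sum_mset_nth:
  fixes T :: "(int ^ 'n) multiset"
  assumes "finite A" "set_mset T \<subseteq> A"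
  shows "\<Sum>\<^sub># T $ i = (\<Sum>x\<in>A. int (count T x) * x $ i)"
  using assms(2)
proof (induction T)
  case empty
  show ?case by simp
next
  case (add x T)
  have "(\<Sum>y\<in>A. int (count (add_mset x T) y) * y $ i)
      = (\<Sum>y\<in>A. int (count T y) * y $ i + (if x = y then y $ i else 0))"
    by (intro sum.cong) (auto simp: algebra_simps)
  also have "\<dots> = (\<Sum>y\<in>A. int (count T y) * y $ i) + x $ i"
    using add.prems assms(1) by (simp add: sum.distrib sum.delta')
  finally show ?case using add by simp
qed

text \<open>A count function below the multiplicities describes a subsequence, and minimality leaves
  all of \<open>S\<close> as the only non-empty zero-sum one. In this form subsequences can be given
  by formulas for their counts.\<close>

lemma minimal_zero_sum_count_eq:
  fixes S :: "(int ^ 'n) multiset" and c :: "int ^ 'n \<Rightarrow> nat"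
  assumes S: "minimal_zero_sum S"
    and le: "\<And>x. x \<in># S \<Longrightarrow> c x \<le> count S x"
    and zero: "\<And>i. (\<Sum>x\<in>set_mset S. int (c x) * x $ i) = 0"
    and "x \<in># S" "c x \<noteq> 0" and y: "y \<in># S"
  shows "c y = count S y"
proof -
  define T where "T = (\<Sum>x\<in>set_mset S. replicate_mset (c x) x)"
  have T: "count T z = (if z \<in># S then c z else 0)" for z
    by (simp add: T_def count_sum)
  have "T \<subseteq># S"
    by (rule mset_subset_eqI) (simp add: T le)
  moreover have "T \<noteq> {#}"
    using T[of x] assms(4,5) by auto
  moreover have "\<Sum>\<^sub># T = 0"
  proof (rule vec_eq_iff[THEN iffD2], rule allI)
    fix i
    have "set_mset T \<subseteq> set_mset S"
      using \<open>T \<subseteq># S\<close> by (rule set_mset_mono)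
    then show "\<Sum>\<^sub># T $ i = 0 $ i"
      using zero[of i] by (simp add: sum_mset_nth[OF finite_set_mset] T)
  qed
  ultimately have "T = S"
    using S unfolding minimal_zero_sum_def by (metis subset_mset.less_le)
  then show ?thesis using T[of y] y by simp
qed

lemma minimal_zero_sum_nth:
  fixes S :: "(int ^ 'n) multiset"
  assumes "minimal_zero_sum S"
  shows "(\<Sum>x\<in>set_mset S. int (count S x) * x $ i) = 0"
  using assms sum_mset_nth[of "set_mset S" S i] by (simp add: minimal_zero_sum_def)

section \<open>Multiplicities when the support lies in a hyperplane\<close>

text \<open>
  Following the segment from \<open>0\<close> to the multiplicity vector of \<open>S\<close> and rounding down gives
  \<open>N\<close> subsequences whose sums stay in a bounded box; by minimality these sums are distinct.
\<close>

lemma count_le_if_orthogonal: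
  fixes S :: "(int ^ 'n) multiset" and v :: "int ^ 'n"
  assumes S: "minimal_zero_sum S" and cube: "set_mset S \<subseteq> int_cube m"
    and v: "v \<noteq> 0" "\<And>x. x \<in># S \<Longrightarrow> (\<Sum>i\<in>UNIV. v $ i * x $ i) = 0"
  shows "count S z \<le> (2 * card (set_mset S) * m + 1) ^ (CARD('n) - 1)"
proof -
  define K where "K = card (set_mset S) * m"
  define N where "N = Max (count S ` set_mset S)"
  have ne: "set_mset S \<noteq> {}"
    using S by (auto simp: minimal_zero_sum_def)
  have countN: "count S x \<le> N" for x
    by (cases "x \<in># S") (auto simp: N_def not_in_iff)
  obtain x0 where x0: "x0 \<in># S" "count S x0 = N"
    using Max_in[of "count S ` set_mset S"] ne unfolding N_def
    by (metis (no_types, lifting) finite_imageI finite_set_mset image_iff image_is_empty)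
  have "N > 0"
    using x0 by auto
  obtain j where j: "v $ j \<noteq> 0"
    using v(1) by (auto simp: vec_eq_iff)
  \<comment> \<open>\<open>N\<close> is the largest multiplicity, attained at \<open>x0\<close>, so
    the rounded count of \<open>x0\<close> at stage \<open>k\<close> is exactly
    \<open>k\<close>.\<close>
  define s :: "nat \<Rightarrow> 'n \<Rightarrow> int" where
    "s k i = (\<Sum>x\<in>set_mset S. int (k * count S x div N) * x $ i)" for k i
  have abs_le: "\<bar>x $ i\<bar> \<le> int m" if "x \<in># S" for x i
  proof -
    have "x $ i \<in> {- int m..int m}" using that cube by (auto simp: int_cube_def)
    then show ?thesis by auto
  qed
  \<comment> \<open>The unrounded sum vanishes, so only the rounding remainders, each below
    \<open>N\<close>, contribute to \<open>N * s k\<close>. Dividing by \<open>N\<close> leaves at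
    most \<open>m\<close> per element of the support.\<close>
  have s_bound: "\<bar>s k i\<bar> \<le> int K" for k i
  proof -
    have "int N * s k i = (\<Sum>x\<in>set_mset S. int (N * (k * count S x div N)) * x $ i)"
      by (simp add: s_def sum_distrib_left mult.assoc)
    also have "\<dots> = (\<Sum>x\<in>set_mset S. int k * (int (count S x) * x $ i)
        - int (k * count S x mod N) * x $ i)"
    proof (rule sum.cong[OF refl])
      fix x
      have "int (N * (k * count S x div N)) = int (k * count S x) - int (k * count S x mod N)"
        by (metis add_diff_cancel_right' mult_div_mod_eq of_nat_add)
      then show "int (N * (k * count S x div N)) * x $ i
        = int k * (int (count S x) * x $ i) - int (k * count S x mod N) * x $ i"
        by (simp add: left_diff_distrib)
    qed
    also have "\<dots> = - (\<Sum>x\<in>set_mset S. int (k * count S x mod N) * x $ i)"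
      using minimal_zero_sum_nth[OF S, of i]
      by (simp add: sum_subtractf flip: sum_distrib_left)
    finally have "int N * \<bar>s k i\<bar> = \<bar>\<Sum>x\<in>set_mset S. int (k * count S x mod N) * x $ i\<bar>"
      by (metis abs_minus_cancel abs_mult abs_of_nat)
    also have "\<dots> \<le> (\<Sum>x\<in>set_mset S. \<bar>int (k * count S x mod N) * x $ i\<bar>)"
      by (rule sum_abs)
    also have "\<dots> \<le> (\<Sum>x\<in>set_mset S. int N * int m)"
    proof (rule sum_mono)
      fix x assume x: "x \<in> set_mset S"
      have "k * count S x mod N \<le> N" using \<open>N > 0\<close> by (simp add: less_imp_le)
      then have "int (k * count S x mod N) \<le> int N" by simp
      then show "\<bar>int (k * count S x mod N) * x $ i\<bar> \<le> int N * int m"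
        unfolding abs_mult using abs_le[OF x] by (intro mult_mono) auto
    qed
    also have "\<dots> = int N * int K"
      by (simp add: K_def)
    finally show ?thesis
      using \<open>N > 0\<close> by simp
  qed
  have s_orth: "(\<Sum>i\<in>UNIV. v $ i * s k i) = 0" for k
  proof -
    have "(\<Sum>i\<in>UNIV. v $ i * s k i)
        = (\<Sum>x\<in>set_mset S. int (k * count S x div N) * (\<Sum>i\<in>UNIV. v $ i * x $ i))"
      unfolding s_def sum_distrib_left by (subst sum.swap) (simp add: algebra_simps)
    also have "\<dots> = 0"
      using v(2) by simp
    finally show ?thesis .
  qed
  have s_neq: "s k \<noteq> s l" if "k < l" "l < N" for k l
  proof
    assume eq: "s k = s l"
    \<comment> \<open>The difference of the two rounded subsequences has zero sum and takes
      \<open>l - k\<close> copies of \<open>x0\<close>: more than none, but fewer than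
      \<open>N\<close>.\<close>
    define c where "c x = l * count S x div N - k * count S x div N" for x
    have mono: "k * count S x div N \<le> l * count S x div N" for x
      using that by (intro div_le_mono mult_le_mono1) simp
    have "c x0 = count S x0"
    proof (rule minimal_zero_sum_count_eq[OF S])
      fix x assume "x \<in># S"
      have "l * count S x div N \<le> N * count S x div N"
        using that by (intro div_le_mono mult_le_mono1) simp
      then show "c x \<le> count S x" using \<open>N > 0\<close> by (simp add: c_def)
    next
      fix i
      have "(\<Sum>x\<in>set_mset S. int (c x) * x $ i) = s l i - s k i"
        by (simp add: c_def s_def of_nat_diff[OF mono] sum_subtractf left_diff_distrib)
      then show "(\<Sum>x\<in>set_mset S. int (c x) * x $ i) = 0" using eq by simp
    qed (use x0 \<open>N > 0\<close> that in \<open>auto simp: c_def\<close>)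
    then show False using x0 \<open>N > 0\<close> that by (simp add: c_def)
  qed
  \<comment> \<open>As \<open>v $ j \<noteq> 0\<close>, orthogonality recovers coordinate
    \<open>j\<close> from the others. Forgetting it keeps the sums distinct and saves a factor
    \<open>2 * K + 1\<close> when counting lattice points.\<close>
  define p where "p k = restrict (s k) (UNIV - {j})" for k
  have "inj_on p {..<N}"
  proof (rule inj_onI)
    fix k l assume kl: "k \<in> {..<N}" "l \<in> {..<N}" and eq: "p k = p l"
    have s_eq: "s k i = s l i" if "i \<noteq> j" for i
      using fun_cong[OF eq, of i] that by (simp add: p_def)
    have split: "v $ j * s k' j = - (\<Sum>i\<in>UNIV - {j}. v $ i * s k' i)" for k'
      using s_orth[of k'] by (simp add: sum.remove[of UNIV j])
    have "v $ j * s k j = v $ j * s l j"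
      unfolding split by (simp add: s_eq)
    then have "s k i = s l i" for i
      using s_eq[of i] j by (cases "i = j") auto
    then have "s k = s l" by blast
    then show "k = l"
      using s_neq[of k l] s_neq[of l k] kl by (metis lessThan_iff nat_neq_iff)
  qed
  moreover have "p ` {..<N} \<subseteq> (UNIV - {j}) \<rightarrow>\<^sub>E {- int K..int K}"
    using s_bound by (auto simp: p_def abs_le_iff minus_le_iff split: if_splits)
  ultimately have "card {..<N} \<le> card ((UNIV - {j}) \<rightarrow>\<^sub>E {- int K..int K})"
    by (intro card_inj_on_le finite_PiE) auto
  also have "\<dots> = (2 * K + 1) ^ (CARD('n) - 1)"
    by (simp add: card_PiE card_Diff_singleton nat_add_distrib nat_mult_distrib)
  finally show ?thesis
    using countN[of z] by (simp add: K_def mult.assoc)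
qed

section \<open>Determinants and linear relations in dimension three\<close>

text \<open>The scalar triple product of \<open>a\<close>, \<open>b\<close>, \<open>c\<close>,
  spelled out as a polynomial so that the identities below are plain algebra.\<close>

definition det3 :: "int ^ 3 \<Rightarrow> int ^ 3 \<Rightarrow> int ^ 3 \<Rightarrow> int" where
  "det3 a b c = a $ 1 * (b $ 2 * c $ 3 - b $ 3 * c $ 2)
     - a $ 2 * (b $ 1 * c $ 3 - b $ 3 * c $ 1) + a $ 3 * (b $ 1 * c $ 2 - b $ 2 * c $ 1)"

text \<open>A non-zero cross product of two vectors of \<open>A\<close> is a normal vector, since
  its inner product with \<open>x\<close> is a triple product. If all cross products vanish,
  \<open>A\<close> lies on a line, and a normal vector exists with last coordinate 0.\<close>

lemma exists_orthogonal_if_det3_eq_0: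
  assumes "\<And>a b c. a \<in> A \<Longrightarrow> b \<in> A \<Longrightarrow> c \<in> A \<Longrightarrow> det3 a b c = 0"
  shows "\<exists>v. v \<noteq> 0 \<and> (\<forall>x\<in>A. (\<Sum>i\<in>UNIV. v $ i * x $ i) = 0)"
proof -
  define cross :: "int ^ 3 \<Rightarrow> int ^ 3 \<Rightarrow> int ^ 3" where
    "cross a b = vector [a $ 2 * b $ 3 - a $ 3 * b $ 2, a $ 3 * b $ 1 - a $ 1 * b $ 3,
       a $ 1 * b $ 2 - a $ 2 * b $ 1]" for a b
  show ?thesis
  proof (cases "\<exists>a\<in>A. \<exists>b\<in>A. cross a b \<noteq> 0")
    case True
    then obtain a b where ab: "a \<in> A" "b \<in> A" "cross a b \<noteq> 0" by blast
    have "(\<Sum>i\<in>UNIV. cross a b $ i * x $ i) = det3 x a b" for x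
      by (simp add: cross_def sum_3 det3_def algebra_simps)
    then show ?thesis using ab assms by auto
  next
    case False
    then have par: "a $ 2 * b $ 3 = a $ 3 * b $ 2" "a $ 3 * b $ 1 = a $ 1 * b $ 3"
      "a $ 1 * b $ 2 = a $ 2 * b $ 1" if "a \<in> A" "b \<in> A" for a b
      using that by (auto simp: cross_def vec_eq_iff forall_3)
    show ?thesis
    proof (cases "\<exists>a\<in>A. a $ 1 \<noteq> 0 \<or> a $ 2 \<noteq> 0")
      case True
      then obtain a where a: "a \<in> A" "a $ 1 \<noteq> 0 \<or> a $ 2 \<noteq> 0" by blast
      then show ?thesis
        using par[OF a(1)]
        by (intro exI[of _ "vector [- a $ 2, a $ 1, 0]"]) (auto simp: sum_3 vec_eq_iff forall_3)
    next
      case False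
      then show ?thesis
        by (intro exI[of _ "vector [1, 0, 0]"]) (auto simp: sum_3 vec_eq_iff forall_3)
    qed
  qed
qed

text \<open>Expansion of a 4 by 4 determinant with columns \<open>a\<close>, \<open>b\<close>,
  \<open>c\<close>, \<open>d\<close> in which the row of coordinate \<open>i\<close> occurs twice.
  The signed minors are thus coefficients of an integer relation.\<close>

lemma det3_relation:
  "det3 b c d * a $ i - det3 a c d * b $ i + det3 a b d * c $ i - det3 a b c * d $ i = 0"
  using exhaust_3[of i] by (auto simp: det3_def algebra_simps)

text \<open>Substituting the relation for \<open>x\<close> times \<open>a\<close> leaves one term,
  as determinants with a repeated vector vanish. If \<open>det3 b c d\<close> is non-zero, the
  coefficients are therefore proportional to the signed minors.\<close>

lemma det3_exchange:
  assumes "\<And>i. x * a $ i + y * b $ i + z * c $ i + w * d $ i = 0"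
  shows "x * det3 a c d = - y * det3 b c d"
    and "x * det3 a b d = z * det3 b c d"
    and "x * det3 a b c = - w * det3 b c d"
  using assms[of 1] assms[of 2] assms[of 3] unfolding det3_def by algebra+

section \<open>Volume of a simplex in the cube\<close>

lemma abs_cross_le:
  fixes p q r s :: int
  assumes "\<bar>p\<bar> \<le> 2 * m" "\<bar>q\<bar> \<le> 2 * m" "\<bar>r\<bar> \<le> 2 * m" "\<bar>s\<bar> \<le> 2 * m"
  shows "\<bar>p * s - q * r\<bar> \<le> 8 * m\<^sup>2"
proof -
  have "\<bar>p * s\<bar> \<le> 2 * m * (2 * m)" "\<bar>q * r\<bar> \<le> 2 * m * (2 * m)"
    unfolding abs_mult using assms by (intro mult_mono; simp)+
  then show ?thesis by (simp add: power2_eq_square)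
qed

text \<open>
  The quantity is \<open>\<Sum>i. X i * C i\<close> in the first coordinates \<open>X\<close>, with \<open>\<Sum>i. C i = 0\<close>.
  The \<open>C i\<close>, and the sums of two of them, are planar cross products of differences.
\<close>

lemma det3_alternating_sum_le:
  assumes "\<And>i. \<bar>a $ i\<bar> \<le> m" "\<And>i. \<bar>b $ i\<bar> \<le> m" "\<And>i. \<bar>c $ i\<bar> \<le> m" "\<And>i. \<bar>d $ i\<bar> \<le> m"
  shows "\<bar>det3 b c d - det3 a c d + det3 a b d - det3 a b c\<bar> \<le> 16 * m ^ 3"
proof -
  define A where "A = (c $ 3 - b $ 3) * (d $ 2 - b $ 2) - (c $ 2 - b $ 2) * (d $ 3 - b $ 3)"
  define B where "B = (c $ 2 - a $ 2) * (d $ 3 - a $ 3) - (c $ 3 - a $ 3) * (d $ 2 - a $ 2)"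
  define C where "C = (b $ 3 - a $ 3) * (d $ 2 - a $ 2) - (b $ 2 - a $ 2) * (d $ 3 - a $ 3)"
  define D where "D = (b $ 2 - a $ 2) * (c $ 3 - a $ 3) - (b $ 3 - a $ 3) * (c $ 2 - a $ 2)"
  have diff: "\<bar>x - y\<bar> \<le> 2 * m" if "\<bar>x\<bar> \<le> m" "\<bar>y\<bar> \<le> m" for x y :: int
    using that by linarith
  have sum0: "A + B + C + D = 0"
    by (simp add: A_def B_def C_def D_def algebra_simps)
  have A: "\<bar>A\<bar> \<le> 8 * m\<^sup>2"
    using abs_cross_le[of "c $ 3 - b $ 3" m "c $ 2 - b $ 2" "d $ 3 - b $ 3" "d $ 2 - b $ 2"]
    by (simp add: A_def diff assms)
  have B: "\<bar>B\<bar> \<le> 8 * m\<^sup>2"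
    using abs_cross_le[of "c $ 2 - a $ 2" m "c $ 3 - a $ 3" "d $ 2 - a $ 2" "d $ 3 - a $ 3"]
    by (simp add: B_def diff assms)
  have C: "\<bar>C\<bar> \<le> 8 * m\<^sup>2"
    using abs_cross_le[of "b $ 3 - a $ 3" m "b $ 2 - a $ 2" "d $ 3 - a $ 3" "d $ 2 - a $ 2"]
    by (simp add: C_def diff assms)
  have D: "\<bar>D\<bar> \<le> 8 * m\<^sup>2"
    using abs_cross_le[of "b $ 2 - a $ 2" m "b $ 3 - a $ 3" "c $ 2 - a $ 2" "c $ 3 - a $ 3"]
    by (simp add: D_def diff assms)
  \<comment> \<open>A sum of two terms is a cross product of opposite edges of the projected
    tetrahedron, so it obeys the same bound as a single term.\<close>
  have "B + C = (c $ 2 - b $ 2) * (d $ 3 - a $ 3) - (c $ 3 - b $ 3) * (d $ 2 - a $ 2)"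
    by (simp add: B_def C_def algebra_simps)
  then have BC: "\<bar>B + C\<bar> \<le> 8 * m\<^sup>2"
    using abs_cross_le[of "c $ 2 - b $ 2" m "c $ 3 - b $ 3" "d $ 2 - a $ 2" "d $ 3 - a $ 3"]
    by (simp add: diff assms)
  have "C + D = (b $ 2 - a $ 2) * (c $ 3 - d $ 3) - (b $ 3 - a $ 3) * (c $ 2 - d $ 2)"
    by (simp add: C_def D_def algebra_simps)
  then have CD: "\<bar>C + D\<bar> \<le> 8 * m\<^sup>2"
    using abs_cross_le[of "b $ 2 - a $ 2" m "b $ 3 - a $ 3" "c $ 2 - d $ 2" "c $ 3 - d $ 3"]
    by (simp add: diff assms)
  have "B + D = (c $ 2 - a $ 2) * (d $ 3 - b $ 3) - (c $ 3 - a $ 3) * (d $ 2 - b $ 2)"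
    by (simp add: B_def D_def algebra_simps)
  then have BD: "\<bar>B + D\<bar> \<le> 8 * m\<^sup>2"
    using abs_cross_le[of "c $ 2 - a $ 2" m "c $ 3 - a $ 3" "d $ 2 - b $ 2" "d $ 3 - b $ 3"]
    by (simp add: diff assms)
  \<comment> \<open>Because the total is 0, the sum of absolute values is twice the sum of the
    positive terms. Up to complements, these form one of the seven partial sums bounded
    above.\<close>
  have sum: "\<bar>A\<bar> + \<bar>B\<bar> + \<bar>C\<bar> + \<bar>D\<bar> \<le> 16 * m\<^sup>2"
    using sum0 A B C D BC CD BD by linarith
  have "det3 b c d - det3 a c d + det3 a b d - det3 a b c
      = a $ 1 * A + b $ 1 * B + c $ 1 * C + d $ 1 * D"
    by (simp add: det3_def A_def B_def C_def D_def algebra_simps)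
  also have "\<bar>\<dots>\<bar> \<le> \<bar>a $ 1 * A\<bar> + \<bar>b $ 1 * B\<bar> + \<bar>c $ 1 * C\<bar> + \<bar>d $ 1 * D\<bar>"
    by linarith
  also have "\<dots> \<le> m * \<bar>A\<bar> + m * \<bar>B\<bar> + m * \<bar>C\<bar> + m * \<bar>D\<bar>"
    unfolding abs_mult using assms by (intro add_mono mult_right_mono) auto
  also have "\<dots> \<le> m * (16 * m\<^sup>2)"
    using mult_left_mono[OF sum, of m] assms(1)[of 1] by (simp add: algebra_simps)
  finally show ?thesis by (simp add: power2_eq_square power3_eq_cube)
qed


section \<open>Upper bound on the length\<close>

text \<open>The multiplicities are a rational multiple of the signed minors. Were the factor above 1
  in absolute value, the absolute minors would describe a proper zero-sum subsequence.\<close>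

lemma size_le_if_det3_neq_0:
  assumes S: "minimal_zero_sum S" and cube: "set_mset S \<subseteq> int_cube m"
    and set: "set_mset S = {a, b, c, d}" and distinct: "distinct [a, b, c, d]"
    and det: "det3 a b c \<noteq> 0"
  shows "size S \<le> 16 * m ^ 3"
proof -
  define x y z w where "x = int (count S a)" and "y = int (count S b)"
    and "z = int (count S c)" and "w = int (count S d)"
  have pos: "x > 0" "y > 0" "z > 0" "w > 0"
    using set by (auto simp: x_def y_def z_def w_def)
  have "x * a $ i + y * b $ i + z * c $ i + w * d $ i = 0" for i
    using minimal_zero_sum_nth[OF S, of i] distinct
    by (simp add: set x_def y_def z_def w_def add.assoc)
  note ex = det3_exchange[OF this]
  \<comment> \<open>Positive multiplicities force the alternating minors to share one sign, which
    \<open>\<sigma>\<close> turns positive.\<close>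
  define \<sigma> where "\<sigma> = sgn (det3 b c d)"
  define A B C D where "A = \<sigma> * det3 b c d" and "B = - \<sigma> * det3 a c d"
    and "C = \<sigma> * det3 a b d" and "D = - \<sigma> * det3 a b c"
  have rel: "x * B = y * A" "x * C = z * A" "x * D = w * A"
    using ex by (simp_all add: A_def B_def C_def D_def algebra_simps)
  have "det3 b c d \<noteq> 0"
    using ex(3) det pos by auto
  then have "A > 0" and \<sigma>: "\<bar>\<sigma>\<bar> = 1"
    by (simp_all add: A_def \<sigma>_def sgn_if)
  then have "x * B > 0" "x * C > 0" "x * D > 0"
    unfolding rel using pos by simp_all
  then have ABCD: "A > 0" "B > 0" "C > 0" "D > 0"
    using pos \<open>A > 0\<close> by (simp_all add: zero_less_mult_iff)
  have "x \<le> A"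
  proof (rule ccontr)
    assume "\<not> x \<le> A"
    then have "A < x" by simp
    have lt: "E < e" if "x * E = e * A" "e > 0" for E e
    proof -
      have "x * E < x * e"
        using that \<open>A < x\<close> by (simp add: mult.commute)
      then show ?thesis using pos by simp
    qed
    define f where
      "f u = nat (if u = a then A else if u = b then B else if u = c then C else D)" for u
    have "f a = count S a"
    proof (rule minimal_zero_sum_count_eq[OF S])
      fix u assume "u \<in># S"
      moreover have "A < x" "B < y" "C < z" "D < w"
        using \<open>A < x\<close> lt rel pos by simp_all
      ultimately show "f u \<le> count S u"
        using distinct by (auto simp: set f_def x_def y_def z_def w_def)
    next
      fix i
      have "(\<Sum>u\<in>set_mset S. int (f u) * u $ i) = A * a $ i + B * b $ i + C * c $ i + D * d $ i"
        using distinct ABCD by (auto simp: set f_def)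
      also have "\<dots> = \<sigma> * (det3 b c d * a $ i - det3 a c d * b $ i
          + det3 a b d * c $ i - det3 a b c * d $ i)"
        by (simp add: A_def B_def C_def D_def algebra_simps)
      finally show "(\<Sum>u\<in>set_mset S. int (f u) * u $ i) = 0"
        by (simp add: det3_relation)
    qed (use ABCD set in \<open>auto simp: f_def\<close>)
    then show False using \<open>A < x\<close> ABCD by (simp add: f_def x_def)
  qed
  then have le: "e \<le> E" if "x * E = e * A" "E > 0" for E e
  proof -
    have "e * A \<le> E * A"
      unfolding that(1)[symmetric] using that(2) \<open>x \<le> A\<close> by (simp add: mult.commute)
    then show ?thesis using \<open>A > 0\<close> by simp
  qed
  have "int (size S) = x + y + z + w"
    using distinct by (simp add: size_multiset_overloaded_eq set x_def y_def z_def w_def)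
  also have "\<dots> \<le> A + B + C + D"
    using \<open>x \<le> A\<close> le[OF rel(1)] le[OF rel(2)] le[OF rel(3)] ABCD by simp
  also have "\<dots> = \<sigma> * (det3 b c d - det3 a c d + det3 a b d - det3 a b c)"
    by (simp add: A_def B_def C_def D_def algebra_simps)
  also have "\<dots> \<le> \<bar>\<sigma> * (det3 b c d - det3 a c d + det3 a b d - det3 a b c)\<bar>"
    by (rule abs_ge_self)
  also have "\<dots> \<le> 16 * int m ^ 3"
  proof -
    have "\<bar>u $ i\<bar> \<le> int m" if "u \<in> {a, b, c, d}" for u i
    proof -
      have "u $ i \<in> {- int m..int m}" using that cube set by (auto simp: int_cube_def)
      then show ?thesis by auto
    qed
    then show ?thesis
      unfolding abs_mult \<sigma> by (simp add: det3_alternating_sum_le)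
  qed
  finally have "int (size S) \<le> int (16 * m ^ 3)" by simp
  then show ?thesis by (simp only: of_nat_le_iff)
qed

text \<open>The maximum is taken because the planar bound exceeds the cubic one for small
  \<open>m\<close>.\<close>

lemma size_le_if_support_4:
  fixes S :: "(int ^ 3) multiset"
  assumes S: "S \<in> min_zero_sum_seqs 4 (int_cube m)"
  shows "size S \<le> max (16 * m ^ 3) (4 * (8 * m + 1)\<^sup>2)"
proof -
  have min: "minimal_zero_sum S" and cube: "set_mset S \<subseteq> int_cube m"
    and card: "card (set_mset S) = 4"
    using S by (auto simp: min_zero_sum_seqs_def)
  show ?thesis
  proof (cases "\<exists>a\<in>set_mset S. \<exists>b\<in>set_mset S. \<exists>c\<in>set_mset S. det3 a b c \<noteq> 0")
    case True
    then obtain a b c where abc: "{a, b, c} \<subseteq> set_mset S" "det3 a b c \<noteq> 0"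
      by blast
    have distinct: "distinct [a, b, c]"
      using abc(2) by (auto simp: det3_def algebra_simps)
    have "card (set_mset S - {a, b, c}) = 1"
      using abc(1) distinct card by (subst card_Diff_subset) auto
    then obtain d where d: "set_mset S - {a, b, c} = {d}"
      by (rule card_1_singletonE)
    have "size S \<le> 16 * m ^ 3"
    proof (rule size_le_if_det3_neq_0[OF min cube _ _ abc(2)])
      show "set_mset S = {a, b, c, d}" using abc(1) d by blast
      show "distinct [a, b, c, d]" using distinct d by auto
    qed
    then show ?thesis by simp
  next
    case False
    then have "\<exists>v. v \<noteq> 0 \<and> (\<forall>x\<in>set_mset S. (\<Sum>i\<in>UNIV. v $ i * x $ i) = 0)"
      by (intro exists_orthogonal_if_det3_eq_0) blast
    then obtain v where v: "v \<noteq> 0" "\<And>x. x \<in># S \<Longrightarrow> (\<Sum>i\<in>UNIV. v $ i * x $ i) = 0"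
      by blast
    \<comment> \<open>\<open>8 * m + 1\<close> is \<open>2 * 4 * m + 1\<close> for four support
      elements, and the exponent 2 is the dimension minus 1.\<close>
    have "size S \<le> (\<Sum>x\<in>set_mset S. (8 * m + 1)\<^sup>2)"
      unfolding size_multiset_overloaded_eq
      using count_le_if_orthogonal[OF min cube v] card by (intro sum_mono) simp
    then show ?thesis using card by simp
  qed
qed

section \<open>Lower bound from coprime minors\<close>

text \<open>The multiplicities of a zero-sum subsequence are a rational multiple of the minors.
  Coprimality, given as a Bezout identity, makes the factor an integer, and containment in the full
  sequence leaves only 0 and 1.\<close>

lemma minimal_zero_sum_if_bezout:
  fixes a b c d :: "int ^ 3" and A B C D :: nat
  assumes distinct: "distinct [a, b, c, d]"
    and D: "int A = det3 b c d" "int B = - det3 a c d" "int C = det3 a b d" "int D = - det3 a b c"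
    and pos: "A > 0"
    and bezout: "p * int A + q * int B + r * int C + s * int D = 1"
  shows "minimal_zero_sum
    (replicate_mset A a + replicate_mset B b + replicate_mset C c + replicate_mset D d)"
    (is "minimal_zero_sum ?S")
  unfolding minimal_zero_sum_def
proof (intro conjI allI impI)
  have sub: "set_mset ?S \<subseteq> {a, b, c, d}" by auto
  have count: "count ?S a = A" "count ?S b = B" "count ?S c = C" "count ?S d = D"
    using distinct by auto
  have nth: "\<Sum>\<^sub># T $ i = int (count T a) * a $ i + int (count T b) * b $ i
      + int (count T c) * c $ i + int (count T d) * d $ i"
    if "set_mset T \<subseteq> {a, b, c, d}" for T i
    using distinct by (subst sum_mset_nth[OF _ that]) auto
  show "?S \<noteq> {#}" using pos by simp
  have "\<Sum>\<^sub># ?S $ i = 0" for i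
    unfolding nth[OF sub] count D using det3_relation[of b c d a i] by simp
  then show "\<Sum>\<^sub># ?S = 0" by (simp add: vec_eq_iff)
  fix T assume T: "T \<subset># ?S \<and> T \<noteq> {#}"
  have le: "count T u \<le> count ?S u" for u
    by (rule mset_subset_eq_count[OF subset_mset.less_imp_le]) (use T in blast)
  have setT: "set_mset T \<subseteq> {a, b, c, d}"
    using T sub by (meson set_mset_mono subset_mset.less_imp_le subset_trans)
  show "\<Sum>\<^sub># T \<noteq> 0"
  proof
    assume "\<Sum>\<^sub># T = 0"
    define x y z w where "x = int (count T a)" and "y = int (count T b)"
      and "z = int (count T c)" and "w = int (count T d)"
    have "x * a $ i + y * b $ i + z * c $ i + w * d $ i = 0" for i
      using nth[OF setT, of i] \<open>\<Sum>\<^sub># T = 0\<close> by (simp add: x_def y_def z_def w_def)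
    from det3_exchange[OF this]
    have rel: "x * int B = y * int A" "x * int C = z * int A" "x * int D = w * int A"
      using D by simp_all
    \<comment> \<open>Applying the Bezout coefficients to the multiplicities produces the
      proportionality factor as an integer.\<close>
    define t where "t = p * x + q * y + r * z + s * w"
    have "int A * t = p * (x * int A) + q * (y * int A) + r * (z * int A) + s * (w * int A)"
      by (simp add: t_def algebra_simps)
    also have "\<dots> = x * (p * int A + q * int B + r * int C + s * int D)"
      unfolding rel[symmetric] by (simp add: algebra_simps)
    finally have "int A * t = x * (p * int A + q * int B + r * int C + s * int D)" .
    then have x: "x = int A * t" using bezout by simp
    have yzw: "y = int B * t" "z = int C * t" "w = int D * t"
      using rel pos unfolding x by (simp_all add: algebra_simps)
    have "0 \<le> x" "x \<le> int A"
      using le[of a] count by (simp_all add: x_def)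
    then have "t = 0 \<or> t = 1"
      using pos unfolding x by (auto simp: zero_le_mult_iff mult_le_cancel_left1)
    then show False
    proof
      assume "t = 0"
      then have "count T u = 0" if "u \<in> {a, b, c, d}" for u
        using that x yzw by (auto simp: x_def y_def z_def w_def)
      then have "set_mset T = {}" using setT by (metis count_eq_zero_iff equals0I subsetD)
      then show False using T by simp
    next
      assume "t = 1"
      then have "count T u = count ?S u" if "u \<in> {a, b, c, d}" for u
        using that x yzw count by (auto simp: x_def y_def z_def w_def)
      moreover have "count T u = count ?S u" if "u \<notin> {a, b, c, d}" for u
        using that le[of u] by auto
      ultimately have "T = ?S" by (intro multiset_eqI) blast
      then show False using T by simp
    qed
  qed
qed

text \<open>
  Perturbing the vertices of a regular tetrahedron inscribed in the cube makes the
  multiplicities coprime: the second and fourth differ by \<open>m\<close> and the first is \<open>-1\<close> modulo \<open>m\<close>.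
\<close>

lemma exists_long_min_zero_sum_seq:
  assumes "m \<ge> 2"
  shows "\<exists>S \<in> min_zero_sum_seqs 4 (int_cube m :: (int ^ 3) set).
    real (size S) = 16 * real m ^ 3 - 16 * real m ^ 2 + 6 * real m - 1"
proof -
  define M where "M = int m"
  have M: "M \<ge> 2" using assms by (simp add: M_def)
  \<comment> \<open>Without the corrections by 1 these are alternate vertices of the cube, and all
    signed minors equal \<open>4 * M ^ 3\<close>, far from coprime.\<close>
  define a b c d :: "int ^ 3" where "a = vector [M, M, M]" and "b = vector [1 - M, M, - M]"
    and "c = vector [M, - M, 1 - M]" and "d = vector [1 - M, 1 - M, M]"
  have distinct: "distinct [a, b, c, d]"
    using M by (auto simp: a_def b_def c_def d_def vec_eq_iff forall_3)
  \<comment> \<open>The first minor is \<open>M * (4 * (M - 1)\<^sup>2) - 1\<close>, which would be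
    negative at \<open>M = 1\<close>.\<close>
  have "4 * (M - 1)\<^sup>2 \<ge> 4 * 1\<^sup>2" using M by (intro mult_left_mono power_mono) auto
  then have "M * (4 * (M - 1)\<^sup>2) \<ge> 2 * 4" using M by (intro mult_mono) auto
  then have A: "4 * M ^ 3 - 8 * M\<^sup>2 + 4 * M - 1 > 0"
    by (simp add: power2_eq_square power3_eq_cube algebra_simps)
  \<comment> \<open>These products are factored forms of the third and the second minor.\<close>
  have "M * (2 * M - 1)\<^sup>2 > 0" "2 * M\<^sup>2 * (2 * M - 1) > 0"
    using M by (auto intro!: mult_pos_pos)
  then have B: "4 * M ^ 3 - 2 * M\<^sup>2 > 0" and C: "4 * M ^ 3 - 4 * M\<^sup>2 + M > 0"
    by (simp_all add: power2_eq_square power3_eq_cube algebra_simps)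
  have D: "4 * M ^ 3 - 2 * M\<^sup>2 + M > 0" using B M by linarith
  define \<alpha> \<beta> \<gamma> \<delta> where "\<alpha> = nat (4 * M ^ 3 - 8 * M\<^sup>2 + 4 * M - 1)"
    and "\<beta> = nat (4 * M ^ 3 - 2 * M\<^sup>2)"
    and "\<gamma> = nat (4 * M ^ 3 - 4 * M\<^sup>2 + M)"
    and "\<delta> = nat (4 * M ^ 3 - 2 * M\<^sup>2 + M)"
  have int: "int \<alpha> = 4 * M ^ 3 - 8 * M\<^sup>2 + 4 * M - 1" "int \<beta> = 4 * M ^ 3 - 2 * M\<^sup>2"
    "int \<gamma> = 4 * M ^ 3 - 4 * M\<^sup>2 + M" "int \<delta> = 4 * M ^ 3 - 2 * M\<^sup>2 + M"
    using A B C D by (simp_all add: \<alpha>_def \<beta>_def \<gamma>_def \<delta>_def)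
  have pos: "\<alpha> > 0" "\<beta> > 0" "\<gamma> > 0" "\<delta> > 0"
    using A B C D by (simp_all add: \<alpha>_def \<beta>_def \<gamma>_def \<delta>_def)
  define S where
    "S = replicate_mset \<alpha> a + replicate_mset \<beta> b + replicate_mset \<gamma> c + replicate_mset \<delta> d"
  have "minimal_zero_sum S"
    unfolding S_def
  proof (rule minimal_zero_sum_if_bezout[OF distinct _ _ _ _ pos(1)])
    \<comment> \<open>Here \<open>\<delta> - \<beta>\<close> is \<open>M\<close>, and the weight
      \<open>4 * M\<^sup>2 - 8 * M + 4\<close> turns it into \<open>\<alpha> + 1\<close>.\<close>
    show "- 1 * int \<alpha> + - (4 * M\<^sup>2 - 8 * M + 4) * int \<beta> + 0 * int \<gamma>
        + (4 * M\<^sup>2 - 8 * M + 4) * int \<delta> = 1"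
      unfolding int by (simp add: power2_eq_square power3_eq_cube algebra_simps)
  qed (simp_all add: int a_def b_def c_def d_def det3_def power2_eq_square power3_eq_cube
      algebra_simps)
  moreover have set: "set_mset S = {a, b, c, d}"
    using pos by (auto simp: S_def set_mset_replicate_mset_subset)
  moreover have "{a, b, c, d} \<subseteq> int_cube m"
    using M by (auto simp: int_cube_def a_def b_def c_def d_def forall_3 M_def)
  moreover have "card {a, b, c, d} = 4"
    using distinct_card[OF distinct] by simp
  ultimately have "S \<in> min_zero_sum_seqs 4 (int_cube m)"
    by (simp add: min_zero_sum_seqs_def)
  moreover have "int (size S) = 16 * M ^ 3 - 16 * M\<^sup>2 + 6 * M - 1"
    by (simp add: S_def int)
  then have "real_of_int (int (size S)) = real_of_int (16 * M ^ 3 - 16 * M\<^sup>2 + 6 * M - 1)"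
    by simp
  then have "real (size S) = 16 * real m ^ 3 - 16 * real m ^ 2 + 6 * real m - 1"
    by (simp add: M_def)
  ultimately show ?thesis by blast
qed

section \<open>Asymptotic equivalence\<close>

theorem theorem9:
  "(\<lambda>m::nat. real (davenport_support 4 (int_cube m :: (int ^ 3) set)))
     \<sim>[at_top] (\<lambda>m. 16 * real m ^ 3)"
proof -
  let ?D = "\<lambda>m. davenport_support 4 (int_cube m :: (int ^ 3) set)"
  have lower: "16 * real m ^ 3 - 16 * real m ^ 2 + 6 * real m - 1 \<le> real (?D m)"
    and upper: "?D m \<le> max (16 * m ^ 3) (4 * (8 * m + 1)\<^sup>2)" if m: "m \<ge> 2" for m
  proof -
    obtain S where S: "S \<in> min_zero_sum_seqs 4 (int_cube m :: (int ^ 3) set)"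
      "real (size S) = 16 * real m ^ 3 - 16 * real m ^ 2 + 6 * real m - 1"
      using exists_long_min_zero_sum_seq[OF m] by blast
    \<comment> \<open>Finiteness of the set of sequences makes the supremum a genuine upper
      bound.\<close>
    have "size S \<le> ?D m"
      unfolding davenport_support_def
      using S(1) by (intro cSup_upper bdd_above_finite finite_imageI
          finite_min_zero_sum_seqs finite_int_cube) auto
    then show "16 * real m ^ 3 - 16 * real m ^ 2 + 6 * real m - 1 \<le> real (?D m)"
      using S(2) by linarith
    \<comment> \<open>\<open>S\<close> witnesses non-emptiness, so a bound on all members bounds the
      supremum.\<close>
    show "?D m \<le> max (16 * m ^ 3) (4 * (8 * m + 1)\<^sup>2)"
      unfolding davenport_support_def
      using S(1) size_le_if_support_4 by (intro cSup_least) auto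
  qed
  have lim1: "(\<lambda>m. (16 * real m ^ 3 - 16 * real m ^ 2 + 6 * real m - 1) / (16 * real m ^ 3))
      \<longlonglongrightarrow> 1"
    by real_asymp
  \<comment> \<open>The cubic term eventually exceeds the quadratic one in the maximum.\<close>
  have lim2: "(\<lambda>m. max (16 * real m ^ 3) (4 * (8 * real m + 1)\<^sup>2) / (16 * real m ^ 3)) \<longlonglongrightarrow> 1"
    by real_asymp
  have "(\<lambda>m. real (?D m) / (16 * real m ^ 3)) \<longlonglongrightarrow> 1"
  proof (rule tendsto_sandwich[OF _ _ lim1 lim2])
    show "\<forall>\<^sub>F m in sequentially. (16 * real m ^ 3 - 16 * real m ^ 2 + 6 * real m - 1)
        / (16 * real m ^ 3) \<le> real (?D m) / (16 * real m ^ 3)"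
      using eventually_ge_at_top[of 2]
      by eventually_elim (intro divide_right_mono lower, auto)
    show "\<forall>\<^sub>F m in sequentially. real (?D m) / (16 * real m ^ 3)
        \<le> max (16 * real m ^ 3) (4 * (8 * real m + 1)\<^sup>2) / (16 * real m ^ 3)"
      using eventually_ge_at_top[of 2]
    proof eventually_elim
      case (elim m)
      have "real (?D m) \<le> real (max (16 * m ^ 3) (4 * (8 * m + 1)\<^sup>2))"
        using upper[OF elim] by (simp only: of_nat_le_iff)
      then show ?case by (intro divide_right_mono) (auto simp: of_nat_max add.commute)
    qed
  qed
  then show ?thesis
    by (rule asymp_equivI')
qed

end
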